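(* Let $\mathbf{X}\in\mathbb{R}^{M\times K_x}$, $\mathbf{D}\in\mathbb{R}^{M\times K_d}$ have unit $\ell_2$-norm columns, $\mathbf{G}=[\mathbf{X}\ \ \mathbf{D}]$, $K_g=K_x+K_d>M$. Let $\mathbf{y}=\mathbf{X}\boldsymbol{\alpha}+\mathbf{D}\boldsymbol{\beta}$ with $\boldsymbol{\alpha}\in\mathbb{R}^{K_x}$, $\boldsymbol{\alpha}\ge\mathbf{0}$, and $\boldsymbol{\beta}\in\mathbb{R}^{K_d}$ arbitrary, and let $S_g$ be the number of non-zero entries of $\boldsymbol{\delta}=[\boldsymbol{\alpha}^T\ \boldsymbol{\beta}^T]^T$. If $$S_g<\tfrac12\left(1+\frac{1}{\mu_m}\right),\qquad \mu_m=\max(\mu_g,\mu_d,\mu_x),$$ then the COMB-OMP algorithm applied to $\mathbf{y}$ and $\mathbf{G}$ recovers the $ML_0$ solution.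
   Context: Coherences: $\mu_x=\max_{i\ne j}\frac{|\mathbf{x}_i^T\mathbf{x}_j|}{\|\mathbf{x}_i\|_2\|\mathbf{x}_j\|_2}$, $\mu_d$ is defined likewise for $\mathbf{D}$, and the cross-coherence is $\mu_g=\max_{i,j}\frac{|\mathbf{x}_i^T\mathbf{d}_j|}{\|\mathbf{x}_i\|_2\|\mathbf{d}_j\|_2}$; convention $1/0=+\infty$. The $ML_0$ solution is the unique minimizer (when it exists) of the number of non-zero entries $\|\boldsymbol{\delta}\|_0$ among $\boldsymbol{\delta}=[\boldsymbol{\alpha}^T\ \boldsymbol{\beta}^T]^T$ with $\mathbf{y}=\mathbf{G}\boldsymbol{\delta}$ and $\boldsymbol{\alpha}\ge\mathbf{0}$. "Recovers the $ML_0$ solution" means that the represented vector $\boldsymbol{\delta}$ is the $ML_0$ solution and is the output of the algorithm. COMB-OMP algorithm. Let $\mathbf{g}_i$ be the columns of $\mathbf{G}$, $\bar{\mathcal{X}}=\{1,\dots,K_x\}$ and $\bar{\mathcal{D}}=\{K_x+1,\dots,K_g\}$. Initialize $t=0$, $\boldsymbol{\delta}_0=\mathbf{0}$, $\mathbf{r}_0=\mathbf{y}$, $\mathcal{X}_0=\mathcal{D}_0=\mathcal{G}_0=\emptyset$. At each iteration: (1) compute $\pi(i)=\mathbf{r}_t^T\mathbf{g}_i/\|\mathbf{g}_i\|_2$ for $1\le i\le K_g$; (2) let $\hat i=\arg\max_{i\in\bar{\mathcal{X}}\setminus\mathcal{X}_t}[\pi(i)]^{+}$ (where $[s]^+=\max(s,0)$),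 $\hat j=\arg\max_{j\in\bar{\mathcal{D}}\setminus\mathcal{D}_t}|\pi(j)|$, and let $\hat k$ be $\hat i$ or $\hat j$ according to which of $[\pi(\hat i)]^+$, $|\pi(\hat j)|$ is larger; if $\hat k\in\bar{\mathcal{X}}$ set $\mathcal{X}_{t+1}=\mathcal{X}_t\cup\{\hat k\}$, $\mathcal{D}_{t+1}=\mathcal{D}_t$, otherwise $\mathcal{D}_{t+1}=\mathcal{D}_t\cup\{\hat k\}$, $\mathcal{X}_{t+1}=\mathcal{X}_t$; set $\mathcal{G}_{t+1}=\mathcal{X}_{t+1}\cup\mathcal{D}_{t+1}$; (3) let $\boldsymbol{\delta}_{t+1}$ minimize $\|\mathbf{y}-\mathbf{G}\boldsymbol{\delta}\|_2$ over vectors $\boldsymbol{\delta}$ supported on $\mathcal{G}_{t+1}$ whose entries indexed by $\mathcal{X}_t$ are non-negative; (4) set $\mathbf{r}_{t+1}=\mathbf{y}-\mathbf{G}\boldsymbol{\delta}_{t+1}$ and increase $t$ by one. Iterations stop when the residual is zero (tolerance $\epsilon=0$, with the maximal number of iterations $T$ at least $S_g$), and the current $\boldsymbol{\delta}_t$ is the output. The final debiasing step of the paper's algorithm is ignored in this analysis. *)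

theory Defs
  imports "HOL-Analysis.Analysis"
begin

text \<open>
  Columns of the concatenated matrix [X D] are indexed by the sum type \<open>'kx + 'kd\<close>:
  \<open>Inl\<close> marks the columns of X, \<open>Inr\<close> those of D.
\<close>

definition hconcat :: "real ^ 'kx ^ 'm \<Rightarrow> real ^ 'kd ^ 'm \<Rightarrow> real ^ ('kx::finite + 'kd::finite) ^ 'm"
  where "hconcat X D = (\<chi> m k. case k of Inl i \<Rightarrow> X $ m $ i | Inr j \<Rightarrow> D $ m $ j)"

definition vconcat :: "real ^ 'kx \<Rightarrow> real ^ 'kd \<Rightarrow> real ^ ('kx::finite + 'kd::finite)"
  where "vconcat a b = (\<chi> k. case k of Inl i \<Rightarrow> a $ i | Inr j \<Rightarrow> b $ j)"

definition l0norm :: "real ^ 'n::finite \<Rightarrow> nat"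
  where "l0norm v = card {k. v $ k \<noteq> 0}"

text \<open>
  For a matrix with a single column there is no pair \<open>i \<noteq> j\<close>; inserting 0 fixes the value 0 in
  that case and changes nothing otherwise, all the quotients being non-negative.
\<close>

definition coherence :: "real ^ 'n::finite ^ 'm::finite \<Rightarrow> real"
  where "coherence A =
    Max (insert 0 {\<bar>column i A \<bullet> column j A\<bar> / (norm (column i A) * norm (column j A)) | i j. i \<noteq> j})"

definition cross_coherence ::
    "real ^ 'kx::finite ^ 'm::finite \<Rightarrow> real ^ 'kd::finite ^ 'm \<Rightarrow> real"
  where "cross_coherence X D =
    Max {\<bar>column i X \<bullet> column j D\<bar> / (norm (column i X) * norm (column j D)) | i j. True}"

definition ML0_feasible ::
    "real ^ ('kx::finite + 'kd::finite) ^ 'm \<Rightarrow> real ^ 'm \<Rightarrow> real ^ ('kx + 'kd) \<Rightarrow> bool"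
  where "ML0_feasible G y d \<longleftrightarrow> y = G *v d \<and> (\<forall>i. 0 \<le> d $ Inl i)"

definition is_ML0_solution ::
    "real ^ ('kx::finite + 'kd::finite) ^ 'm \<Rightarrow> real ^ 'm \<Rightarrow> real ^ ('kx + 'kd) \<Rightarrow> bool"
  where "is_ML0_solution G y d \<longleftrightarrow>
    is_arg_min l0norm (ML0_feasible G y) d \<and>
    (\<forall>d'. is_arg_min l0norm (ML0_feasible G y) d' \<longrightarrow> d' = d)"

section \<open>The COMB-OMP algorithm\<close>

record ('kx, 'kd, 'm) comb_omp_state =
  est :: "real ^ ('kx + 'kd)"
  resid :: "real ^ 'm"
  selX :: "('kx + 'kd) set"
  selD :: "('kx + 'kd) set"

definition comb_omp_init ::
    "real ^ 'm \<Rightarrow> ('kx::finite, 'kd::finite, 'm::finite) comb_omp_state"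
  where "comb_omp_init y = \<lparr>est = 0, resid = y, selX = {}, selD = {}\<rparr>"

definition comb_omp_corr :: "real ^ 'n::finite ^ 'm::finite \<Rightarrow> real ^ 'm \<Rightarrow> 'n \<Rightarrow> real"
  where "comb_omp_corr G r k = (r \<bullet> column k G) / norm (column k G)"

text \<open>
  The best unselected indices \<open>i\<close> and \<open>j\<close> of the two blocks compete, and the one with the larger
  value is chosen.  All ways of breaking ties (inside a block or between the blocks) are admitted.
  A block with no unselected index has no candidate, and then the other block's candidate is taken.
\<close>

definition comb_omp_selects ::
    "real ^ ('kx + 'kd) ^ 'm \<Rightarrow> ('kx::finite, 'kd::finite, 'm::finite) comb_omp_state
      \<Rightarrow> ('kx + 'kd) \<Rightarrow> bool"
  where "comb_omp_selects G s k \<longleftrightarrow>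
    (let p = comb_omp_corr G (resid s);
         best_i = is_arg_max (\<lambda>i. max (p i) 0) (\<lambda>i. i \<in> range Inl - selX s);
         best_j = is_arg_max (\<lambda>j. \<bar>p j\<bar>) (\<lambda>j. j \<in> range Inr - selD s)
     in (best_i k \<and> (\<forall>j. best_j j \<longrightarrow> \<bar>p j\<bar> \<le> max (p k) 0)) \<or>
        (best_j k \<and> (\<forall>i. best_i i \<longrightarrow> max (p i) 0 \<le> \<bar>p k\<bar>)))"

text \<open>
  In the least-squares step the sign constraint concerns the X-indices selected \<^emph>\<open>before\<close> the
  current iteration (\<open>selX s\<close>), whereas the support constraint includes the new index.
\<close>

definition comb_omp_step ::
    "real ^ ('kx + 'kd) ^ 'm \<Rightarrow> real ^ 'm
      \<Rightarrow> ('kx::finite, 'kd::finite, 'm::finite) comb_omp_state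
      \<Rightarrow> ('kx, 'kd, 'm) comb_omp_state \<Rightarrow> bool"
  where "comb_omp_step G y s s' \<longleftrightarrow>
    (\<exists>k. comb_omp_selects G s k \<and>
       selX s' = (if k \<in> range Inl then insert k (selX s) else selX s) \<and>
       selD s' = (if k \<in> range Inl then selD s else insert k (selD s)) \<and>
       is_arg_min (\<lambda>d. norm (y - G *v d))
         (\<lambda>d. (\<forall>l. l \<notin> selX s' \<union> selD s' \<longrightarrow> d $ l = 0) \<and> (\<forall>l \<in> selX s. 0 \<le> d $ l))
         (est s') \<and>
       resid s' = y - G *v est s')"

definition comb_omp_halted ::
    "nat \<Rightarrow> nat \<Rightarrow> ('kx::finite, 'kd::finite, 'm::finite) comb_omp_state \<Rightarrow> bool"
  where "comb_omp_halted T t s \<longleftrightarrow> resid s = 0 \<or> T \<le> t"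

text \<open>\<open>comb_omp_reach G y T t s\<close>: some run with iteration limit \<open>T\<close> is in state \<open>s\<close> after \<open>t\<close> iterations.\<close>

inductive comb_omp_reach ::
    "real ^ ('kx + 'kd) ^ 'm \<Rightarrow> real ^ 'm \<Rightarrow> nat \<Rightarrow> nat
      \<Rightarrow> ('kx::finite, 'kd::finite, 'm::finite) comb_omp_state \<Rightarrow> bool"
  for G y T
  where
    init: "comb_omp_reach G y T 0 (comb_omp_init y)"
  | step: "comb_omp_reach G y T t s \<Longrightarrow> \<not> comb_omp_halted T t s \<Longrightarrow> comb_omp_step G y s s'
      \<Longrightarrow> comb_omp_reach G y T (Suc t) s'"

definition comb_omp_output ::
    "real ^ ('kx::finite + 'kd::finite) ^ 'm::finite \<Rightarrow> real ^ 'm \<Rightarrow> nat \<Rightarrow> real ^ ('kx + 'kd) \<Rightarrow> bool"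
  where "comb_omp_output G y T d \<longleftrightarrow>
    (\<exists>t s. comb_omp_reach G y T t s \<and> comb_omp_halted T t s \<and> d = est s)"

text \<open>
  Whatever choices are made among maximizers and minimizers, the algorithm outputs \<open>d\<close>: no run gets
  stuck (hence every run halts, after at most \<open>T\<close> iterations) and \<open>d\<close> is the only possible output.
\<close>

definition comb_omp_returns ::
    "real ^ ('kx::finite + 'kd::finite) ^ 'm::finite \<Rightarrow> real ^ 'm \<Rightarrow> nat \<Rightarrow> real ^ ('kx + 'kd) \<Rightarrow> bool"
  where "comb_omp_returns G y T d \<longleftrightarrow>
    (\<forall>t s. comb_omp_reach G y T t s \<and> \<not> comb_omp_halted T t s \<longrightarrow> (\<exists>s'. comb_omp_step G y s s')) \<and>
    {d'. comb_omp_output G y T d'} = {d}"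

end

theory Submission
  imports Defs
begin

text \<open>
  Let \<open>S\<close> be the support of \<open>\<delta>\<close>, with \<open>n\<close> elements.  The sparsity bound is equivalent to
  \<open>n \<mu> < 1 - (n - 1) \<mu>\<close>, and everything rests on what this says about a vector \<open>v\<close> that is
  largest in absolute value at \<open>k\<close>.  In the sum \<open>\<langle>g\<^sub>j, G v\<rangle> = (\<Sum>i. v\<^sub>i \<langle>g\<^sub>j, g\<^sub>i\<rangle>)\<close> every
  term with \<open>i \<noteq> j\<close> has absolute value at most \<open>\<mu> \<bar>v\<^sub>k\<bar>\<close>, and the one with \<open>i = j\<close> is \<open>v\<^sub>j\<close>
  (\<open>correlation_deviation\<close>).  If \<open>v \<noteq> 0\<close> lives on \<open>S\<close>, then \<open>\<langle>g\<^sub>k, G v\<rangle>\<close> therefore has the sign of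
  \<open>v\<^sub>k\<close> and exceeds in absolute value all \<open>\<langle>g\<^sub>j, G v\<rangle>\<close> with \<open>j\<close> outside \<open>S\<close>
  (\<open>peak_dominates\<close>).  If \<open>v \<noteq> 0\<close> has up to \<open>2 n\<close> non-zero entries, then at least \<open>G v \<noteq> 0\<close>
  (\<open>no_sparse_kernel\<close>); applied to the difference of \<open>\<delta>\<close> and another representation of \<open>y\<close>
  that is as sparse, this gives the \<open>ML\<^sub>0\<close> part.

  For the algorithm, the state after \<open>t\<close> iterations has selected \<open>t\<close> indices, all in \<open>S\<close>,
  and its residual is \<open>G v\<close> for the error \<open>v = \<delta> - \<delta>\<^sub>t\<close>, which lives on \<open>S\<close>.  The least-squares
  problem constrains every coordinate separately, by conditions which \<open>\<delta>\<close> satisfies at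
  the selected indices; so an entry of \<open>\<delta>\<^sub>t\<close> may be moved towards that of \<open>\<delta>\<close>, and by minimality
  \<open>v\<^sub>k \<langle>g\<^sub>k, G v\<rangle> \<le> 0\<close> at every selected \<open>k\<close> (\<open>coordinate_variation\<close>).  At the peak of \<open>v \<noteq> 0\<close> this
  product is positive, so the peak has not been selected.  Its entry in \<open>\<delta>\<^sub>t\<close> is thus \<open>0\<close>, and if
  it belongs to the \<open>X\<close> block, then \<open>v\<^sub>k = \<delta>\<^sub>k > 0\<close>: the positive part taken by the algorithm
  does not truncate its correlation.  The peak hence beats all indices outside \<open>S\<close>, and the next
  index selected lies in \<open>S\<close> again (\<open>peak_unselected\<close>).  Since an unselected index of \<open>S\<close> remains as
  long as \<open>v \<noteq> 0\<close>, the error vanishes after at most \<open>n\<close> iterations, and it is \<open>0\<close> exactly when the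
  residual is.
\<close>

section \<open>Correlations of incoherent columns\<close>

abbreviation supp :: "real ^ 'n::finite \<Rightarrow> 'n set"
  where "supp v \<equiv> {k. v $ k \<noteq> 0}"

lemma exists_peak:
  fixes v :: "real ^ 'n::finite"
  obtains k where "\<And>j. \<bar>v $ j\<bar> \<le> \<bar>v $ k\<bar>"
proof -
  have "Max (range (\<lambda>j. \<bar>v $ j\<bar>)) \<in> range (\<lambda>j. \<bar>v $ j\<bar>)"
    by (rule Max_in) auto
  then obtain k where k: "Max (range (\<lambda>j. \<bar>v $ j\<bar>)) = \<bar>v $ k\<bar>" by blast
  have "\<bar>v $ j\<bar> \<le> \<bar>v $ k\<bar>" for j
    unfolding k[symmetric] by (rule Max_ge) auto
  then show ?thesis by (rule that)
qed

lemma peak_nonzero: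
  fixes v :: "real ^ 'n::finite"
  assumes "v \<noteq> 0" "\<And>j. \<bar>v $ j\<bar> \<le> \<bar>v $ k\<bar>"
  shows "v $ k \<noteq> 0"
proof
  assume "v $ k = 0"
  then have "v $ j = 0" for j using assms(2)[of j] by simp
  then show False using assms(1) by (simp add: vec_eq_iff)
qed

locale incoherent_columns =
  fixes G :: "real ^ 'n::finite ^ 'm::finite" and \<mu> :: real
  assumes unit: "norm (column k G) = 1"
    and coh: "i \<noteq> j \<Longrightarrow> \<bar>column i G \<bullet> column j G\<bar> \<le> \<mu>"
    and coh_nonneg: "0 \<le> \<mu>"
begin

lemma correlation_deviation:
  assumes B: "\<And>j. \<bar>v $ j\<bar> \<le> B"
  shows "\<bar>column k G \<bullet> (G *v v) - v $ k\<bar> \<le> real (card (supp v - {k})) * (\<mu> * B)"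
proof -
  let ?t = "\<lambda>j. v $ j * (column k G \<bullet> column j G)"
  have "column k G \<bullet> column k G = 1"
    using unit[of k] by (simp add: dot_square_norm)
  then have self: "?t k = v $ k" by simp
  have "column k G \<bullet> (G *v v) = (\<Sum>j\<in>UNIV. ?t j)"
    by (simp add: matrix_mult_sum inner_sum_right scalar_mult_eq_scaleR)
  also have "\<dots> = ?t k + (\<Sum>j\<in>UNIV - {k}. ?t j)"
    by (simp add: sum.remove)
  also have "(\<Sum>j\<in>UNIV - {k}. ?t j) = (\<Sum>j\<in>supp v - {k}. ?t j)"
    by (rule sum.mono_neutral_right) auto
  finally have "\<bar>column k G \<bullet> (G *v v) - v $ k\<bar> = \<bar>\<Sum>j\<in>supp v - {k}. ?t j\<bar>"
    using self by simp
  also have "\<dots> \<le> (\<Sum>j\<in>supp v - {k}. \<bar>?t j\<bar>)" by (rule sum_abs)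
  also have "\<dots> \<le> (\<Sum>j\<in>supp v - {k}. \<mu> * B)"
  proof (rule sum_mono)
    fix j assume "j \<in> supp v - {k}"
    then have "\<bar>column k G \<bullet> column j G\<bar> \<le> \<mu>" using coh[of k j] by auto
    then have "\<bar>v $ j\<bar> * \<bar>column k G \<bullet> column j G\<bar> \<le> B * \<mu>"
      using B[of j] by (intro mult_mono) auto
    then show "\<bar>?t j\<bar> \<le> \<mu> * B" by (simp add: abs_mult mult.commute)
  qed
  finally show ?thesis by simp
qed

text \<open>
  At the peak, only the other \<open>card (supp v) - 1\<close> entries can cancel the contribution of the peak
  itself to its correlation; the \<open>\<mu>\<close> on the right of the bound accounts for the entry not counted.
\<close>

lemma no_sparse_kernel:
  assumes "real (card (supp v)) * \<mu> < 1 + \<mu>" "G *v v = 0"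
  shows "v = 0"
proof (rule ccontr)
  assume "v \<noteq> 0"
  obtain k where k: "\<And>j. \<bar>v $ j\<bar> \<le> \<bar>v $ k\<bar>" using exists_peak by blast
  have nz: "v $ k \<noteq> 0" using peak_nonzero[OF \<open>v \<noteq> 0\<close> k] .
  then have "Suc (card (supp v - {k})) = card (supp v)"
    by (intro card_Suc_Diff1) auto
  then have "real (card (supp v - {k})) = real (card (supp v)) - 1" by linarith
  then have "\<bar>v $ k\<bar> \<le> (real (card (supp v)) - 1) * \<mu> * \<bar>v $ k\<bar>"
    using correlation_deviation[OF k, of k] assms(2) by (simp add: mult.assoc)
  moreover have "(real (card (supp v)) - 1) * \<mu> * \<bar>v $ k\<bar> < 1 * \<bar>v $ k\<bar>"
    using assms(1) nz by (intro mult_strict_right_mono) (auto simp: algebra_simps)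
  ultimately show False by simp
qed

lemma peak_dominates:
  assumes sub: "supp v \<subseteq> S" and small: "2 * real (card S) * \<mu> < 1 + \<mu>"
    and "v \<noteq> 0" and k: "\<And>j. \<bar>v $ j\<bar> \<le> \<bar>v $ k\<bar>"
  shows "0 < v $ k * (column k G \<bullet> (G *v v))"
    and "j \<notin> S \<Longrightarrow> \<bar>column j G \<bullet> (G *v v)\<bar> < \<bar>column k G \<bullet> (G *v v)\<bar>"
proof -
  let ?c = "\<lambda>j. column j G \<bullet> (G *v v)"
  let ?n = "real (card S)"
  have nz: "v $ k \<noteq> 0" using peak_nonzero[OF \<open>v \<noteq> 0\<close> k] .
  have kS: "k \<in> S" using nz sub by auto
  have B0: "0 \<le> \<mu> * \<bar>v $ k\<bar>" using coh_nonneg by simp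
  have "card (supp v - {k}) < card S"
    using sub kS by (intro psubset_card_mono) auto
  then have "real (card (supp v - {k})) \<le> ?n - 1" by linarith
  then have "real (card (supp v - {k})) * (\<mu> * \<bar>v $ k\<bar>) \<le> (?n - 1) * (\<mu> * \<bar>v $ k\<bar>)"
    using B0 by (rule mult_right_mono)
  then have dev: "\<bar>?c k - v $ k\<bar> \<le> (?n - 1) * (\<mu> * \<bar>v $ k\<bar>)"
    using correlation_deviation[OF k, of k] by linarith
  have gap: "?n * (\<mu> * \<bar>v $ k\<bar>) < \<bar>v $ k\<bar> - (?n - 1) * (\<mu> * \<bar>v $ k\<bar>)"
    using mult_strict_right_mono[OF small, of "\<bar>v $ k\<bar>"] nz by (simp add: algebra_simps)
  have n0: "0 \<le> ?n * (\<mu> * \<bar>v $ k\<bar>)" using B0 by simp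
  show "0 < v $ k * ?c k"
    using dev gap n0 nz by (cases "0 < v $ k") (auto simp: zero_less_mult_iff)
  assume "j \<notin> S"
  then have "v $ j = 0" using sub by auto
  moreover have "real (card (supp v - {j})) * (\<mu> * \<bar>v $ k\<bar>) \<le> ?n * (\<mu> * \<bar>v $ k\<bar>)"
    using sub B0 by (intro mult_right_mono) (auto intro!: card_mono)
  ultimately have "\<bar>?c j\<bar> \<le> ?n * (\<mu> * \<bar>v $ k\<bar>)"
    using correlation_deviation[OF k, of j] by simp
  then show "\<bar>?c j\<bar> < \<bar>?c k\<bar>" using dev gap by linarith
qed

end

section \<open>Constrained least squares\<close>

text \<open>
  The lower bound on \<open>norm (G *v d)\<close> makes the sublevel sets of the objective bounded, so that
  a minimum over a compact part of \<open>C\<close> is a minimum over \<open>C\<close>.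
\<close>

lemma least_squares_attained:
  fixes G :: "real ^ 'n::finite ^ 'm::finite"
  assumes "closed C" "d0 \<in> C" "0 < e" and low: "\<And>d. d \<in> C \<Longrightarrow> e * norm d \<le> norm (G *v d)"
  obtains d where "d \<in> C" "\<And>d'. d' \<in> C \<Longrightarrow> norm (y - G *v d) \<le> norm (y - G *v d')"
proof -
  let ?f = "\<lambda>d. norm (y - G *v d)"
  let ?r = "(norm y + ?f d0) / e"
  have far: "norm d \<le> ?r" if "d \<in> C" "?f d \<le> ?f d0" for d
  proof -
    have "norm (G *v d) \<le> norm y + ?f d"
      using norm_triangle_ineq4[of y "y - G *v d"] by simp
    then have "e * norm d \<le> norm y + ?f d0" using low[OF that(1)] that(2) by linarith
    then show ?thesis using \<open>0 < e\<close> by (simp add: field_simps)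
  qed
  have "compact (C \<inter> cball 0 ?r)" using \<open>closed C\<close> by (simp add: closed_Int_compact)
  moreover have d0: "d0 \<in> C \<inter> cball 0 ?r" using far[of d0] \<open>d0 \<in> C\<close> by simp
  moreover have "continuous_on (C \<inter> cball 0 ?r) ?f"
    by (intro continuous_intros linear_continuous_on matrix_vector_mul_bounded_linear)
  ultimately obtain d where d: "d \<in> C \<inter> cball 0 ?r"
      and min: "\<And>d'. d' \<in> C \<inter> cball 0 ?r \<Longrightarrow> ?f d \<le> ?f d'"
    using continuous_attains_inf[of "C \<inter> cball 0 ?r" ?f] by blast
  have "?f d \<le> ?f d'" if "d' \<in> C" for d'
  proof (cases "?f d' \<le> ?f d0")
    case True
    then show ?thesis using far[OF that] min[of d'] that by simp
  next
    case False
    then show ?thesis using min[OF d0] by linarith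
  qed
  then show ?thesis using d that by blast
qed

text \<open>
  Moving one entry by the fraction \<open>\<epsilon>\<close> of \<open>a\<close> changes the squared norm of the residual by
  \<open>- 2 \<epsilon> a \<langle>g\<^sub>k, r\<rangle> + O(\<epsilon>\<^sup>2)\<close>, which is negative for small \<open>\<epsilon>\<close> if \<open>a \<langle>g\<^sub>k, r\<rangle> > 0\<close>.
\<close>

lemma coordinate_variation:
  fixes G :: "real ^ 'n::finite ^ 'm::finite"
  assumes min: "\<And>\<epsilon>. 0 < \<epsilon> \<Longrightarrow> \<epsilon> \<le> 1 \<Longrightarrow>
      norm (y - G *v d) \<le> norm (y - G *v (d + axis k (\<epsilon> * a)))"
  shows "a * (column k G \<bullet> (y - G *v d)) \<le> 0"
proof (rule ccontr)
  let ?r = "y - G *v d"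
  define b where "b = a * (column k G \<bullet> ?r)"
  define q where "q = (norm (a *\<^sub>R column k G))\<^sup>2"
  assume "\<not> ?thesis"
  then have b: "0 < b" by (simp add: b_def)
  have q: "0 \<le> q" by (simp add: q_def)
  have ineq: "2 * b \<le> \<epsilon> * q" if \<epsilon>: "0 < \<epsilon>" "\<epsilon> \<le> 1" for \<epsilon>
  proof -
    have "G *v axis k (\<epsilon> * a) = \<epsilon> *\<^sub>R (a *\<^sub>R column k G)"
      by (simp add: vec_eq_iff matrix_vector_mult_def axis_def column_def if_distrib
          sum.delta cong: if_cong)
    then have moved: "y - G *v (d + axis k (\<epsilon> * a)) = ?r - \<epsilon> *\<^sub>R (a *\<^sub>R column k G)"
      by (simp add: matrix_vector_right_distrib)
    have "(norm ?r)\<^sup>2 \<le> (norm (?r - \<epsilon> *\<^sub>R (a *\<^sub>R column k G)))\<^sup>2"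
      using min[OF \<epsilon>] unfolding moved by (rule power_mono) simp
    also have "\<dots> = (norm ?r)\<^sup>2 - 2 * \<epsilon> * b + \<epsilon> * \<epsilon> * q"
      unfolding b_def q_def dot_square_norm[symmetric]
      by (simp add: inner_diff_left inner_diff_right inner_commute algebra_simps)
    finally have "\<epsilon> * (2 * b) \<le> \<epsilon> * (\<epsilon> * q)" by (simp add: algebra_simps)
    then show ?thesis using \<epsilon> by (simp add: mult_le_cancel_left)
  qed
  define \<epsilon> where "\<epsilon> = min 1 (b / (q + 1))"
  have "0 < \<epsilon>" "\<epsilon> \<le> 1" using b q by (auto simp: \<epsilon>_def)
  then have "2 * b \<le> \<epsilon> * q" by (rule ineq)
  also have "\<dots> \<le> b / (q + 1) * q" using q by (intro mult_right_mono) (auto simp: \<epsilon>_def)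
  also have "\<dots> \<le> b" using b q by (simp add: field_simps)
  finally show False using b by simp
qed

section \<open>The selection rule as a single maximization\<close>

abbreviation selected :: "('kx::finite, 'kd::finite, 'm::finite) comb_omp_state \<Rightarrow> ('kx + 'kd) set"
  where "selected s \<equiv> selX s \<union> selD s"

definition score :: "real ^ ('kx + 'kd) ^ 'm \<Rightarrow> ('kx::finite, 'kd::finite, 'm::finite) comb_omp_state
    \<Rightarrow> ('kx + 'kd) \<Rightarrow> real"
  where "score G s k = (let p = comb_omp_corr G (resid s) k in
    case k of Inl _ \<Rightarrow> max p 0 | Inr _ \<Rightarrow> \<bar>p\<bar>)"

lemma is_arg_max_cong:
  assumes "\<And>x. P x \<Longrightarrow> f x = g x"
  shows "is_arg_max f P k \<longleftrightarrow> is_arg_max g P k"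
  using assms by (auto simp: is_arg_max_def)

lemma is_arg_max_iff_linorder:
  fixes f :: "'a \<Rightarrow> 'b::linorder"
  shows "is_arg_max f P k \<longleftrightarrow> P k \<and> (\<forall>j. P j \<longrightarrow> f j \<le> f k)"
  by (auto simp: is_arg_max_def not_less)

lemma ex_is_arg_max:
  fixes f :: "'a::finite \<Rightarrow> 'b::linorder"
  assumes "P a"
  shows "\<exists>k. is_arg_max f P k"
proof -
  have "Max (f ` Collect P) \<in> f ` Collect P" using assms by (intro Max_in) auto
  then obtain k where "P k" "Max (f ` Collect P) = f k" by auto
  then have "is_arg_max f P k"
    by (metis (mono_tags) Max_ge finite finite_imageI image_eqI is_arg_max_iff_linorder mem_Collect_eq)
  then show ?thesis ..
qed

text \<open>This is where finiteness enters: any member is beaten by some champion.\<close>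

lemma all_arg_max_le_iff:
  fixes f :: "'a::finite \<Rightarrow> 'b::linorder"
  shows "(\<forall>i. is_arg_max f P i \<longrightarrow> f i \<le> c) \<longleftrightarrow> (\<forall>i. P i \<longrightarrow> f i \<le> c)"
proof (intro iffI allI impI)
  fix i assume le: "\<forall>i. is_arg_max f P i \<longrightarrow> f i \<le> c" and "P i"
  then obtain m where m: "is_arg_max f P m" using ex_is_arg_max[of P i f] by blast
  then have "f i \<le> f m" using \<open>P i\<close> by (simp add: is_arg_max_iff_linorder)
  also have "\<dots> \<le> c" using le m by blast
  finally show "f i \<le> c" .
qed (simp add: is_arg_max_iff_linorder)

lemma is_arg_max_disj:
  fixes f :: "'a::finite \<Rightarrow> 'b::linorder"
  shows "is_arg_max f (\<lambda>x. P x \<or> Q x) k \<longleftrightarrow>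
    (is_arg_max f P k \<and> (\<forall>j. is_arg_max f Q j \<longrightarrow> f j \<le> f k)) \<or>
    (is_arg_max f Q k \<and> (\<forall>i. is_arg_max f P i \<longrightarrow> f i \<le> f k))"
  unfolding all_arg_max_le_iff unfolding is_arg_max_iff_linorder by blast

lemma comb_omp_selects_iff:
  assumes "selX s \<subseteq> range Inl" "selD s \<subseteq> range Inr"
  shows "comb_omp_selects G s k \<longleftrightarrow> is_arg_max (score G s) (\<lambda>k. k \<notin> selected s) k"
proof -
  let ?p = "comb_omp_corr G (resid s)"
  let ?P = "\<lambda>i. i \<in> range Inl - selX s" and ?Q = "\<lambda>j. j \<in> range Inr - selD s"
  have split: "(\<lambda>k. k \<notin> selected s) = (\<lambda>k. ?P k \<or> ?Q k)"
  proof
    fix k show "(k \<notin> selected s) = (?P k \<or> ?Q k)" using assms by (cases k) auto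
  qed
  have X: "is_arg_max (\<lambda>i. max (?p i) 0) ?P = is_arg_max (score G s) ?P"
    by (intro ext is_arg_max_cong) (auto simp: score_def)
  have D: "is_arg_max (\<lambda>j. \<bar>?p j\<bar>) ?Q = is_arg_max (score G s) ?Q"
    by (intro ext is_arg_max_cong) (auto simp: score_def)
  have P: "max (?p i) 0 = score G s i" if "is_arg_max (score G s) ?P i" for i
    using that by (auto simp: is_arg_max_def score_def)
  have Q: "\<bar>?p j\<bar> = score G s j" if "is_arg_max (score G s) ?Q j" for j
    using that by (auto simp: is_arg_max_def score_def)
  show ?thesis
    unfolding comb_omp_selects_def Let_def split is_arg_max_disj X D using P Q by auto
qed

section \<open>Runs of the algorithm on a sparse signal\<close>

locale sparse_signal = incoherent_columns G \<mu>
  for G :: "real ^ ('kx::finite + 'kd::finite) ^ 'm::finite" and \<mu> :: real +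
  fixes y :: "real ^ 'm" and \<delta> :: "real ^ ('kx + 'kd)"
  assumes signal: "y = G *v \<delta>"
    and nonneg: "0 \<le> \<delta> $ Inl i"
    and sparse: "2 * real (l0norm \<delta>) * \<mu> < 1 + \<mu>"
begin

theorem ML0_solution: "is_ML0_solution G y \<delta>"
proof -
  have unique: "d = \<delta>" if "ML0_feasible G y d" "l0norm d \<le> l0norm \<delta>" for d
  proof -
    have "card (supp (d - \<delta>)) \<le> card (supp d \<union> supp \<delta>)"
      by (intro card_mono) auto
    also have "\<dots> \<le> l0norm d + l0norm \<delta>" unfolding l0norm_def by (rule card_Un_le)
    finally have "real (card (supp (d - \<delta>))) \<le> 2 * real (l0norm \<delta>)" using that(2) by linarith
    from mult_right_mono[OF this coh_nonneg] sparse
    have "real (card (supp (d - \<delta>))) * \<mu> < 1 + \<mu>" by linarith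
    moreover have "G *v (d - \<delta>) = 0"
      using that(1) signal by (simp add: ML0_feasible_def matrix_vector_mult_diff_distrib)
    ultimately have "d - \<delta> = 0" by (rule no_sparse_kernel)
    then show ?thesis by simp
  qed
  have feas: "ML0_feasible G y \<delta>" using signal nonneg by (simp add: ML0_feasible_def)
  show ?thesis
    unfolding is_ML0_solution_def is_arg_min_def
    using unique feas by (metis less_imp_le not_less)
qed

text \<open>
  The last conjunct replaces the optimality conditions of the least-squares problem; it is
  all that the selection step needs to know about \<open>est s\<close> at the indices already selected.
\<close>

definition on_track :: "nat \<Rightarrow> ('kx, 'kd, 'm) comb_omp_state \<Rightarrow> bool"
  where "on_track t s \<longleftrightarrow>
    selX s \<subseteq> range Inl \<and> selD s \<subseteq> range Inr \<and>
    selected s \<subseteq> supp \<delta> \<and> card (selected s) = t \<and>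
    (\<forall>l. l \<notin> selected s \<longrightarrow> est s $ l = 0) \<and>
    resid s = G *v (\<delta> - est s) \<and>
    (\<forall>k \<in> selected s. (\<delta> - est s) $ k * (column k G \<bullet> resid s) \<le> 0)"

lemma on_track_init: "on_track 0 (comb_omp_init y)"
  by (simp add: on_track_def comb_omp_init_def signal)

lemma peak_unselected:
  assumes s: "on_track t s" and "est s \<noteq> \<delta>"
  obtains k where "k \<in> supp \<delta>" "k \<notin> selected s" "resid s \<noteq> 0"
    "\<And>j. j \<notin> supp \<delta> \<Longrightarrow> score G s j < score G s k"
proof -
  let ?v = "\<delta> - est s"
  let ?c = "\<lambda>j. column j G \<bullet> resid s"
  have r: "resid s = G *v ?v" and out: "\<And>l. l \<notin> selected s \<Longrightarrow> est s $ l = 0"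
    and sel: "selected s \<subseteq> supp \<delta>"
    and var: "\<And>k. k \<in> selected s \<Longrightarrow> ?v $ k * ?c k \<le> 0"
    using s by (auto simp: on_track_def)
  obtain k where k: "\<And>j. \<bar>?v $ j\<bar> \<le> \<bar>?v $ k\<bar>" using exists_peak by blast
  have sub: "supp ?v \<subseteq> supp \<delta>" using sel out by force
  have "?v \<noteq> 0" using assms(2) by simp
  note dom = peak_dominates[OF sub sparse[unfolded l0norm_def] this k, folded r]
  have unsel: "k \<notin> selected s" using var[of k] dom(1) by force
  then have vk: "?v $ k = \<delta> $ k" using out by simp
  then have "k \<in> supp \<delta>" using dom(1) by auto
  moreover have "resid s \<noteq> 0" using dom(1) by auto
  moreover have "score G s j < score G s k" if "j \<notin> supp \<delta>" for j
  proof -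
    have corr: "comb_omp_corr G (resid s) i = ?c i" for i
      by (simp add: comb_omp_corr_def unit inner_commute)
    have "score G s j \<le> \<bar>?c j\<bar>" by (cases j) (auto simp: score_def corr Let_def)
    also have "\<dots> < \<bar>?c k\<bar>" using that by (rule dom(2))
    also have "\<dots> = score G s k"
    proof (cases k)
      case (Inl i)
      then have "0 < ?c k" using dom(1) vk nonneg[of i] by (simp add: zero_less_mult_iff)
      then show ?thesis using Inl by (simp add: score_def corr)
    qed (simp add: score_def corr)
    finally show ?thesis .
  qed
  ultimately show ?thesis using unsel that by blast
qed

lemma on_track_halted_iff:
  assumes s: "on_track t s" and T: "l0norm \<delta> \<le> T"
  shows "comb_omp_halted T t s \<longleftrightarrow> est s = \<delta>"
proof
  assume "est s = \<delta>"
  then show "comb_omp_halted T t s" using s by (simp add: on_track_def comb_omp_halted_def)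
next
  assume halted: "comb_omp_halted T t s"
  show "est s = \<delta>"
  proof (rule ccontr)
    assume "est s \<noteq> \<delta>"
    then obtain k where k: "k \<in> supp \<delta>" "k \<notin> selected s" "resid s \<noteq> 0"
      using peak_unselected[OF s] by metis
    then have "selected s \<subset> supp \<delta>" using s by (auto simp: on_track_def)
    then have "t < l0norm \<delta>"
      using s by (auto simp: on_track_def l0norm_def intro: psubset_card_mono)
    then show False using halted k(3) T by (simp add: comb_omp_halted_def)
  qed
qed

lemma on_track_step:
  assumes s: "on_track t s" and "est s \<noteq> \<delta>" and step: "comb_omp_step G y s s'"
  shows "on_track (Suc t) s'"
proof -
  let ?C = "\<lambda>d. (\<forall>l. l \<notin> selected s' \<longrightarrow> d $ l = 0) \<and> (\<forall>l \<in> selX s. 0 \<le> d $ l)"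
  have XD: "selX s \<subseteq> range Inl" "selD s \<subseteq> range Inr" and sel: "selected s \<subseteq> supp \<delta>"
    and t: "card (selected s) = t"
    using s by (auto simp: on_track_def)
  from step obtain k where k: "comb_omp_selects G s k"
    and X': "selX s' = (if k \<in> range Inl then insert k (selX s) else selX s)"
    and D': "selD s' = (if k \<in> range Inl then selD s else insert k (selD s))"
    and opt: "is_arg_min (\<lambda>d. norm (y - G *v d)) ?C (est s')"
    and r': "resid s' = y - G *v est s'"
    unfolding comb_omp_step_def by (elim exE conjE) (rule that)
  have kmax: "k \<notin> selected s" "\<And>j. j \<notin> selected s \<Longrightarrow> score G s j \<le> score G s k"
    using k by (auto simp: comb_omp_selects_iff[OF XD] is_arg_max_iff_linorder)
  have kS: "k \<in> supp \<delta>"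
    using peak_unselected[OF s \<open>est s \<noteq> \<delta>\<close>] kmax(2) by (metis not_less)
  have sel': "selected s' = insert k (selected s)" using X' D' by auto
  have feas: "?C (est s')" using opt by (simp add: is_arg_min_def)
  have min: "norm (y - G *v est s') \<le> norm (y - G *v d)" if "?C d" for d
    using opt that by (auto simp: is_arg_min_def not_less)
  have "(\<delta> - est s') $ l * (column l G \<bullet> resid s') \<le> 0" if l: "l \<in> selected s'" for l
    unfolding r'
  proof (rule coordinate_variation, rule min)
    fix \<epsilon> :: real assume \<epsilon>: "0 < \<epsilon>" "\<epsilon> \<le> 1"
    \<comment> \<open>The moved entry is a convex combination of the entries of \<open>est s'\<close> and \<open>\<delta>\<close>.\<close>
    have "0 \<le> (1 - \<epsilon>) * est s' $ l + \<epsilon> * \<delta> $ l" if "l \<in> selX s"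
      using \<epsilon> feas XD(1) nonneg that by (intro add_nonneg_nonneg mult_nonneg_nonneg) auto
    then have "0 \<le> est s' $ l + \<epsilon> * (\<delta> - est s') $ l" if "l \<in> selX s"
      using that by (simp add: algebra_simps)
    then show "?C (est s' + axis l (\<epsilon> * (\<delta> - est s') $ l))"
      using feas l by (auto simp: axis_def)
  qed
  moreover have "k \<in> range Inl \<or> k \<in> range Inr" by (cases k) auto
  then have XD': "selX s' \<subseteq> range Inl" "selD s' \<subseteq> range Inr"
    using X' D' XD by (simp_all split: if_splits)
  moreover have "card (selected s') = Suc t" using kmax(1) t by (simp add: sel')
  moreover have "resid s' = G *v (\<delta> - est s')"
    using r' by (simp add: signal matrix_vector_mult_diff_distrib)
  moreover have "selected s' \<subseteq> supp \<delta>" using sel kS unfolding sel' by blast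
  ultimately show ?thesis
    unfolding on_track_def using feas XD' by (intro conjI ballI) simp_all
qed

text \<open>
  As long as the error is non-zero, its peak is an unselected index, and the least-squares problem
  has a minimizer because \<open>G\<close> is injective, hence bounded below, on the vectors
  supported in \<open>supp \<delta>\<close>.
\<close>

lemma step_exists:
  assumes s: "on_track t s" and "est s \<noteq> \<delta>"
  obtains s' where "comb_omp_step G y s s'"
proof -
  have XD: "selX s \<subseteq> range Inl" "selD s \<subseteq> range Inr" and sel: "selected s \<subseteq> supp \<delta>"
    using s by (auto simp: on_track_def)
  obtain p where p: "p \<notin> selected s" "\<And>j. j \<notin> supp \<delta> \<Longrightarrow> score G s j < score G s p"
    using peak_unselected[OF assms] by metis
  obtain k where k: "is_arg_max (score G s) (\<lambda>k. k \<notin> selected s) k"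
    using ex_is_arg_max[of "\<lambda>k. k \<notin> selected s" p "score G s"] p(1) by blast
  then have "k \<in> supp \<delta>" using p by (metis is_arg_max_def)
  then have S: "insert k (selected s) \<subseteq> supp \<delta>" using sel by auto
  define V where "V = {d :: real ^ ('kx + 'kd). \<forall>j. \<delta> $ j = 0 \<longrightarrow> d $ j = 0}"
  have "subspace V" by (simp add: V_def subspace_def)
  moreover have "\<forall>d \<in> V. G *v d = 0 \<longrightarrow> d = 0"
  proof (intro ballI impI)
    fix d assume "d \<in> V" and ker: "G *v d = 0"
    then have "card (supp d) \<le> l0norm \<delta>" unfolding V_def l0norm_def by (intro card_mono) auto
    then have "real (card (supp d)) * \<mu> \<le> 2 * real (l0norm \<delta>) * \<mu>"
      using coh_nonneg by (intro mult_right_mono) auto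
    then show "d = 0" using sparse ker by (intro no_sparse_kernel) auto
  qed
  ultimately obtain e where e: "0 < e" "\<And>d. d \<in> V \<Longrightarrow> e * norm d \<le> norm (G *v d)"
    using injective_imp_isometric[of V "(*v) G"] by (auto simp: closed_subspace mult.commute)
  define C where "C = {d :: real ^ ('kx + 'kd).
    (\<forall>l. l \<notin> insert k (selected s) \<longrightarrow> d $ l = 0) \<and> (\<forall>l. l \<in> selX s \<longrightarrow> 0 \<le> d $ l)}"
  have "closed {d :: real ^ ('kx + 'kd). d $ l = 0}"
    and "closed {d :: real ^ ('kx + 'kd). 0 \<le> d $ l}" for l
    by (simp_all add: closed_Collect_eq closed_Collect_le continuous_on_component)
  then have "closed C"
    unfolding C_def
    by (intro closed_Collect_conj closed_Collect_all closed_Collect_imp open_Collect_const)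
  moreover have "0 \<in> C" by (simp add: C_def)
  moreover have "C \<subseteq> V" using S by (auto simp: C_def V_def)
  then have "e * norm d \<le> norm (G *v d)" if "d \<in> C" for d using e(2) that by blast
  ultimately obtain d where dC: "d \<in> C"
    and min: "\<And>d'. d' \<in> C \<Longrightarrow> norm (y - G *v d) \<le> norm (y - G *v d')"
    using least_squares_attained[of C 0 e G y] e(1) by metis
  define s' :: "('kx, 'kd, 'm) comb_omp_state" where
    "s' = \<lparr>est = d, resid = y - G *v d,
      selX = (if k \<in> range Inl then insert k (selX s) else selX s),
      selD = (if k \<in> range Inl then selD s else insert k (selD s))\<rparr>"
  have sel': "selected s' = insert k (selected s)" by (auto simp: s'_def)
  have "comb_omp_step G y s s'"
    unfolding comb_omp_step_def
  proof (intro exI conjI)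
    show "comb_omp_selects G s k" using k by (simp only: comb_omp_selects_iff[OF XD])
    have "is_arg_min (\<lambda>d. norm (y - G *v d)) (\<lambda>d. d \<in> C) (est s')"
      using dC min by (auto simp: s'_def is_arg_min_def not_less)
    then show "is_arg_min (\<lambda>d. norm (y - G *v d))
        (\<lambda>d. (\<forall>l. l \<notin> selected s' \<longrightarrow> d $ l = 0) \<and> (\<forall>l \<in> selX s. 0 \<le> d $ l)) (est s')"
      by (simp only: C_def mem_Collect_eq Ball_def sel')
  qed (simp_all add: s'_def)
  then show ?thesis by (rule that)
qed

lemma reach_on_track:
  assumes T: "l0norm \<delta> \<le> T" and "comb_omp_reach G y T t s"
  shows "on_track t s"
  using assms(2)
proof induction
  case init
  show ?case by (rule on_track_init)
next
  case (step t s s')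
  then show ?case using on_track_step on_track_halted_iff[OF _ T] by blast
qed

theorem returns:
  assumes T: "l0norm \<delta> \<le> T"
  shows "comb_omp_returns G y T \<delta>"
proof -
  note track = reach_on_track[OF T]
  have progress: "\<exists>s'. comb_omp_step G y s s'"
    if "comb_omp_reach G y T t s" "\<not> comb_omp_halted T t s" for t s
    using step_exists[OF track[OF that(1)]] on_track_halted_iff[OF track[OF that(1)] T] that(2)
    by blast
  have bound: "t \<le> l0norm \<delta>" if "comb_omp_reach G y T t s" for t s
    using track[OF that] by (auto simp: on_track_def l0norm_def intro!: card_mono)
  \<comment> \<open>A longest run halts, since it cannot be extended.\<close>
  obtain t where t: "\<exists>s. comb_omp_reach G y T t s"
    and longest: "\<And>t'. \<exists>s. comb_omp_reach G y T t' s \<Longrightarrow> t' \<le> t"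
  proof -
    have "\<exists>s. comb_omp_reach G y T 0 s" using comb_omp_reach.init by blast
    moreover have "\<forall>t. (\<exists>s. comb_omp_reach G y T t s) \<longrightarrow> t \<le> l0norm \<delta>" using bound by blast
    ultimately show ?thesis by (rule Nat.ex_has_greatest_nat[elim_format]) (use that in blast)
  qed
  then obtain s where s: "comb_omp_reach G y T t s" by blast
  have halted: "comb_omp_halted T t s"
  proof (rule ccontr)
    assume "\<not> comb_omp_halted T t s"
    then have "\<exists>s'. comb_omp_reach G y T (Suc t) s'"
      using progress[OF s] comb_omp_reach.step[OF s] by blast
    then show False using longest[of "Suc t"] by simp
  qed
  have "{d'. comb_omp_output G y T d'} = {\<delta>}"
    unfolding comb_omp_output_def
    using s halted on_track_halted_iff[OF track T] by blast
  then show ?thesis unfolding comb_omp_returns_def using progress by blast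
qed

end

section \<open>The concatenated dictionary\<close>

lemma column_hconcat_Inl [simp]: "column (Inl i) (hconcat X D) = column i X"
  by (simp add: column_def hconcat_def)

lemma column_hconcat_Inr [simp]: "column (Inr j) (hconcat X D) = column j D"
  by (simp add: column_def hconcat_def)

lemma hconcat_mult_vconcat: "hconcat X D *v vconcat a b = X *v a + D *v b"
  by (simp add: vec_eq_iff matrix_vector_mult_def hconcat_def vconcat_def
      UNIV_Plus_UNIV[symmetric] sum.Plus del: UNIV_Plus_UNIV)

lemma finite_pair_values:
  fixes f :: "'a::finite \<Rightarrow> 'b::finite \<Rightarrow> 'c"
  shows "finite {f i j | i j. P i j}"
  by (rule finite_subset[of _ "range (\<lambda>(i, j). f i j)"]) auto

lemma coherence_bound:
  assumes "\<And>i. norm (column i A) = 1" "i \<noteq> j"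
  shows "\<bar>column i A \<bullet> column j A\<bar> \<le> coherence A"
proof -
  have "\<bar>column i A \<bullet> column j A\<bar> / (norm (column i A) * norm (column j A)) \<le> coherence A"
    unfolding coherence_def using assms(2)
    by (intro Max_ge finite.insertI finite_pair_values) blast
  then show ?thesis by (simp add: assms(1))
qed

lemma coherence_nonneg: "0 \<le> coherence A"
  unfolding coherence_def by (intro Max_ge finite.insertI finite_pair_values insertI1)

lemma cross_coherence_bound:
  assumes "\<And>i. norm (column i X) = 1" "\<And>j. norm (column j D) = 1"
  shows "\<bar>column i X \<bullet> column j D\<bar> \<le> cross_coherence X D"
proof -
  have "\<bar>column i X \<bullet> column j D\<bar> / (norm (column i X) * norm (column j D)) \<le> cross_coherence X D"
    unfolding cross_coherence_def by (intro Max_ge finite_pair_values) blast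
  then show ?thesis by (simp add: assms)
qed

lemma sparsity_bound_real:
  assumes "ereal (real n) < 1 / 2 * (1 + 1 / ereal \<mu>)" "0 \<le> \<mu>"
  shows "2 * real n * \<mu> < 1 + \<mu>"
proof (cases "\<mu> = 0")
  case False
  have "1 / 2 * (1 + 1 / ereal \<mu>) = ereal (1 / 2 * (1 + 1 / \<mu>))"
    using False by (simp add: one_ereal_def numeral_eq_ereal)
  then have "real n < 1 / 2 * (1 + 1 / \<mu>)" using assms(1) by simp
  then show ?thesis using False assms(2) by (simp add: field_simps)
qed simp

theorem theorem3p9:
  fixes X :: "real ^ 'kx::finite ^ 'm::finite"
    and D :: "real ^ 'kd::finite ^ 'm"
    and G :: "real ^ ('kx + 'kd) ^ 'm"
    and y :: "real ^ 'm"
    and \<alpha> :: "real ^ 'kx"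
    and \<beta> :: "real ^ 'kd"
    and \<delta> :: "real ^ ('kx + 'kd)"
    and \<mu>m :: real
    and Sg T :: nat
  assumes unit_X: "\<And>i. norm (column i X) = 1"
    and unit_D: "\<And>j. norm (column j D) = 1"
    and G: "G = hconcat X D"
    and redundant: "CARD('kx) + CARD('kd) > CARD('m)"
    and y: "y = X *v \<alpha> + D *v \<beta>"
    and nonneg: "\<And>i. 0 \<le> \<alpha> $ i"
    and \<delta>: "\<delta> = vconcat \<alpha> \<beta>"
    and Sg: "Sg = l0norm \<delta>"
    and \<mu>m: "\<mu>m = max (cross_coherence X D) (max (coherence D) (coherence X))"
    and sparse: "ereal (real Sg) < 1 / 2 * (1 + 1 / ereal \<mu>m)"
    and T: "Sg \<le> T"
  shows "is_ML0_solution G y \<delta> \<and> comb_omp_returns G y T \<delta>"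
proof -
  have \<mu>0: "0 \<le> \<mu>m" using coherence_nonneg[of X] by (simp add: \<mu>m le_max_iff_disj)
  interpret sparse_signal G \<mu>m y \<delta>
  proof
    fix k show "norm (column k G) = 1" by (cases k) (simp_all add: G unit_X unit_D)
  next
    fix i j :: "'kx + 'kd" assume "i \<noteq> j"
    then show "\<bar>column i G \<bullet> column j G\<bar> \<le> \<mu>m"
      using coherence_bound[OF unit_X] coherence_bound[OF unit_D]
        cross_coherence_bound[OF unit_X unit_D]
      by (cases i; cases j) (auto simp: G \<mu>m le_max_iff_disj inner_commute[of "column _ D" "column _ X"])
  next
    show "y = G *v \<delta>" by (simp add: y G \<delta> hconcat_mult_vconcat)
    show "0 \<le> \<delta> $ Inl i" for i by (simp add: \<delta> vconcat_def nonneg)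
    show "2 * real (l0norm \<delta>) * \<mu>m < 1 + \<mu>m"
      using sparsity_bound_real[OF sparse \<mu>0] Sg by simp
  qed (rule \<mu>0)
  show ?thesis using ML0_solution returns T Sg by simp
qed

end
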